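(* Let $n \geq 0$ and $m \geq 1$ be integers. Write a partition $\lambda$ of $n$ as $\lambda = (\lambda_1 \geq \lambda_2 \geq \cdots \geq \lambda_\ell)$. Let $C_m(n)$ be the set of partitions $\lambda$ of $n$ for which there exist indices $1 \leq i_1 < i_2 < \cdots < i_m \leq \ell$ with $\lambda_{i_j} - \lambda_{i_{j+1}} \geq 2$ for all $1 \leq j \leq m-1$ (i.e. there is a subsequence of length $m$ of the parts in which any two consecutive members differ by at least $2$). Let $D_m(n)$ be the set of partitions of $n$ having at least $m$ parts greater than or equal to $m$. Then $|C_m(n)| = |D_m(n)|$.
   Context: Partitions are finite nonincreasing sequences of positive integers; a part counted with multiplicity contributes one entry to the sequence. *)

theory Defs
  imports Main
begin

definition partitions :: "nat \<Rightarrow> nat list set" where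
  "partitions n = {l. sorted_wrt (\<ge>) l \<and> (\<forall>x\<in>set l. 0 < x) \<and> sum_list l = n}"

(* Only finite sets have a meaningful card. *)
lemma finite_partitions: "finite (partitions n)"
proof (rule finite_subset)
  have "length l \<le> sum_list l" if "\<forall>x\<in>set l. 0 < x" for l :: "nat list"
    using that by (induction l) auto
  moreover have "x \<le> sum_list l" if "x \<in> set l" for x and l :: "nat list"
    using that by (simp add: member_le_sum_list)
  ultimately show "partitions n \<subseteq> {l. set l \<subseteq> {..n} \<and> length l \<le> n}"
    by (auto simp: partitions_def)
qed (rule finite_lists_length_le, simp)

(* List positions start at 0, so i 0 < ... < i (m - 1) are the positions of the chosen
   parts; the gap condition is written additively to avoid truncated subtraction. *)
definition C_set :: "nat \<Rightarrow> nat \<Rightarrow> nat list set" where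
  "C_set m n = {l \<in> partitions n. \<exists>i :: nat \<Rightarrow> nat.
     strict_mono_on {..<m} i \<and> (\<forall>j<m. i j < length l) \<and>
     (\<forall>j. Suc j < m \<longrightarrow> l ! i (Suc j) + 2 \<le> l ! i j)}"

definition D_set :: "nat \<Rightarrow> nat \<Rightarrow> nat list set" where
  "D_set m n = {l \<in> partitions n. m \<le> length (filter (\<lambda>x. m \<le> x) l)}"

end

theory Submission
  imports Defs "HOL-Library.Multiset" "HOL-Computational_Algebra.Formal_Power_Series"
begin

text \<open>
  Generalise to partitions with all parts at least \<open>M\<close>. Let \<open>c k M\<close> be the generating function of
  those having a chain of \<open>k\<close> parts with gaps at least \<open>2\<close>, and \<open>d k M\<close> that of those having at
  least \<open>k\<close> parts that are at least \<open>M + k - 1\<close>. A longest chain can be chosen to end in the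
  smallest part, which then only forbids the parts \<open>M\<close> and \<open>M + 1\<close> for the rest of the chain; hence
  \<open>(1 - q\<^sup>M) (1 - q\<^sup>M\<^sup>+\<^sup>1) (c (k + 1) M - c (k + 1) (M + 1)) = q\<^sup>M c k (M + 2)\<close>.
  The functions \<open>d\<close> satisfy the same recursion, and together with the case \<open>k = 0\<close> it determines
  all of them, because for \<open>k > 0\<close> the coefficient of \<open>q\<^sup>n\<close> vanishes once \<open>M > n\<close>.
\<close>

section \<open>Generating functions of sets of partitions\<close>

text \<open>Multisets replace nonincreasing lists so that a part can be added or removed without
  regard to its position.\<close>

definition parts_ge :: "nat \<Rightarrow> nat multiset set" where
  "parts_ge M = {p. \<forall>x\<in>#p. M \<le> x}"

text \<open>A coefficient is meaningful only if the counted set is finite. Parts 0 could be repeated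
  without changing the sum, hence the recurring assumption
  \<open>S \<subseteq> parts_ge 1\<close>.\<close>

definition gf :: "nat multiset set \<Rightarrow> int fps" where
  "gf S = Abs_fps (\<lambda>n. int (card {p \<in> S. sum_mset p = n}))"

lemma gf_nth: "fps_nth (gf S) n = int (card {p \<in> S. sum_mset p = n})"
  by (simp add: gf_def)

lemma mset_partitions: "bij_betw mset (partitions n) {p \<in> parts_ge 1. sum_mset p = n}"
proof (rule bij_betw_imageI)
  show "inj_on mset (partitions n)"
  proof (rule inj_onI)
    fix l l' assume "l \<in> partitions n" "l' \<in> partitions n" "mset l = mset l'"
    then have "sorted (rev l)" "sorted (rev l')" "mset (rev l) = mset (rev l')"
      by (auto simp: partitions_def sorted_wrt_rev)
    then have "rev l = rev l'"
      by (metis properties_for_sort)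
    then show "l = l'" by simp
  qed
  show "mset ` partitions n = {p \<in> parts_ge 1. sum_mset p = n}"
  proof (intro equalityI subsetI)
    fix p assume "p \<in> mset ` partitions n"
    then show "p \<in> {p \<in> parts_ge 1. sum_mset p = n}"
      by (auto simp: partitions_def parts_ge_def sum_mset_sum_list Suc_le_eq)
  next
    fix p assume p: "p \<in> {p \<in> parts_ge 1. sum_mset p = n}"
    let ?l = "rev (sorted_list_of_multiset p)"
    have "mset ?l = p" by simp
    moreover have "sum_list ?l = sum_mset p"
      by (metis \<open>mset ?l = p\<close> sum_mset_sum_list)
    then have "?l \<in> partitions n"
      using p by (auto simp: partitions_def sorted_wrt_rev parts_ge_def Suc_le_eq)
    ultimately show "p \<in> mset ` partitions n" by (metis imageI)
  qed
qed

lemma finite_partition_msets: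
  assumes "S \<subseteq> parts_ge 1"
  shows "finite {p \<in> S. sum_mset p = n}"
proof (rule finite_subset)
  show "finite {p \<in> parts_ge 1. sum_mset p = n}"
    using bij_betw_finite[OF mset_partitions[of n]] finite_partitions by simp
qed (use assms in auto)

lemma parts_ge_antimono: "M \<le> N \<Longrightarrow> parts_ge N \<subseteq> parts_ge M"
  by (auto simp: parts_ge_def)

lemma parts_ge_Suc_iff: "p \<in> parts_ge (Suc M) \<longleftrightarrow> p \<in> parts_ge M \<and> M \<notin># p"
  by (auto simp: parts_ge_def Suc_le_eq le_less)

lemma gf_Un_disjoint:
  assumes "S \<subseteq> parts_ge 1" "T \<subseteq> parts_ge 1" "S \<inter> T = {}"
  shows "gf (S \<union> T) = gf S + gf T"
proof (rule fps_ext)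
  fix n
  have "{p \<in> S \<union> T. sum_mset p = n} = {p \<in> S. sum_mset p = n} \<union> {p \<in> T. sum_mset p = n}"
    by auto
  moreover have "card \<dots> = card {p \<in> S. sum_mset p = n} + card {p \<in> T. sum_mset p = n}"
    using assms by (intro card_Un_disjoint finite_partition_msets) auto
  ultimately show "fps_nth (gf (S \<union> T)) n = fps_nth (gf S + gf T) n"
    by (simp add: gf_nth)
qed

lemma gf_image_shift:
  assumes "inj_on h S" "\<And>p. p \<in> S \<Longrightarrow> sum_mset (h p) = sum_mset p + k"
  shows "gf (h ` S) = fps_X ^ k * gf S"
proof (rule fps_ext)
  fix n
  have eq: "{p \<in> h ` S. sum_mset p = n} = h ` {p \<in> S. sum_mset p + k = n}"
    using assms(2) by force
  have "card (h ` {p \<in> S. sum_mset p + k = n}) = card {p \<in> S. sum_mset p + k = n}"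
    by (rule card_image) (use assms(1) in \<open>auto simp: inj_on_def\<close>)
  moreover have "{p \<in> S. sum_mset p + k = n} = (if n < k then {} else {p \<in> S. sum_mset p = n - k})"
    by auto
  ultimately show "fps_nth (gf (h ` S)) n = fps_nth (fps_X ^ k * gf S) n"
    unfolding gf_nth eq by (simp add: fps_X_power_mult_nth gf_nth)
qed

lemma gf_split:
  assumes "S \<subseteq> parts_ge 1"
  shows "gf S = gf {p \<in> S. M \<notin># p} + fps_X ^ M * gf {p. add_mset M p \<in> S}"
proof -
  have "S = {p \<in> S. M \<notin># p} \<union> add_mset M ` {p. add_mset M p \<in> S}"
    by (auto simp: image_iff dest: multi_member_split)
  then have "gf S = gf ({p \<in> S. M \<notin># p} \<union> add_mset M ` {p. add_mset M p \<in> S})"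
    by (rule arg_cong)
  also have "\<dots> = gf {p \<in> S. M \<notin># p} + gf (add_mset M ` {p. add_mset M p \<in> S})"
    using assms by (intro gf_Un_disjoint) auto
  also have "gf (add_mset M ` {p. add_mset M p \<in> S}) = fps_X ^ M * gf {p. add_mset M p \<in> S}"
    by (rule gf_image_shift) (auto simp: inj_on_def)
  finally show ?thesis .
qed

section \<open>Parts below the threshold of a condition\<close>

definition constrained :: "(nat multiset \<Rightarrow> bool) \<Rightarrow> nat \<Rightarrow> nat \<Rightarrow> nat multiset set" where
  "constrained Q L M = {p \<in> parts_ge M. Q (filter_mset (\<lambda>x. L \<le> x) p)}"

text \<open>Since \<open>M < L\<close>, the condition \<open>Q\<close> does not see the part
  \<open>M\<close>, so its multiplicity is free and contributes the geometric series
  \<open>1 / (1 - q^M)\<close>.\<close>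

lemma gf_constrained_Suc:
  assumes "0 < M" "M < L"
  shows "(1 - fps_X ^ M) * gf (constrained Q L M) = gf (constrained Q L (Suc M))"
proof -
  let ?S = "constrained Q L M"
  have "?S \<subseteq> parts_ge 1"
    using assms(1) by (auto simp: constrained_def parts_ge_def)
  moreover have "{p \<in> ?S. M \<notin># p} = constrained Q L (Suc M)"
    by (auto simp: constrained_def parts_ge_Suc_iff)
  moreover have "{p. add_mset M p \<in> ?S} = ?S"
    using assms(2) by (auto simp: constrained_def parts_ge_def)
  ultimately show ?thesis
    using gf_split[of ?S M] by (simp add: algebra_simps)
qed

text \<open>Permits cancelling these factors, as integer power series form an integral
  domain.\<close>

lemma one_minus_X_power_nonzero:
  assumes "0 < M"
  shows "1 - fps_X ^ M \<noteq> (0 :: int fps)"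
proof
  assume "1 - fps_X ^ M = (0 :: int fps)"
  then have "fps_nth (1 - fps_X ^ M) 0 = fps_nth (0 :: int fps) 0" by simp
  then show False using assms by (simp add: fps_X_power_iff)
qed

section \<open>Chains with gaps at least two\<close>

text \<open>A set of values suffices: the gaps make the members of a chain distinct, so neither
  multiplicities nor positions matter.\<close>

definition gap_chain :: "nat \<Rightarrow> nat set \<Rightarrow> bool" where
  "gap_chain m A \<longleftrightarrow> (\<exists>f. (\<forall>j<m. f j \<in> A) \<and> (\<forall>j. Suc j < m \<longrightarrow> f (Suc j) + 2 \<le> f j))"

text \<open>Drop the last member of a chain: each earlier one exceeds its successor, which is at
  least \<open>M\<close>, by at least 2. Conversely, \<open>M\<close> can be appended to any chain
  of values at least \<open>M + 2\<close>.\<close>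

lemma gap_chain_insert_least:
  assumes "A \<subseteq> {M..}"
  shows "gap_chain (Suc k) (insert M A) \<longleftrightarrow> gap_chain k (A \<inter> {M + 2..})"
proof
  assume "gap_chain (Suc k) (insert M A)"
  then obtain f where f: "\<And>j. j < Suc k \<Longrightarrow> f j \<in> insert M A"
    "\<And>j. Suc j < Suc k \<Longrightarrow> f (Suc j) + 2 \<le> f j"
    unfolding gap_chain_def by blast
  have "f j \<in> A \<inter> {M + 2..}" if "j < k" for j
  proof -
    have "M \<le> f (Suc j)" using f(1)[of "Suc j"] that assms by auto
    then show ?thesis using f(1)[of j] f(2)[of j] that by auto
  qed
  then show "gap_chain k (A \<inter> {M + 2..})"
    using f(2) unfolding gap_chain_def by (intro exI[of _ f]) auto
next
  assume "gap_chain k (A \<inter> {M + 2..})"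
  then obtain f where f: "\<And>j. j < k \<Longrightarrow> f j \<in> A \<inter> {M + 2..}"
    "\<And>j. Suc j < k \<Longrightarrow> f (Suc j) + 2 \<le> f j"
    unfolding gap_chain_def by blast
  show "gap_chain (Suc k) (insert M A)"
    unfolding gap_chain_def
  proof (intro exI[of _ "f(k := M)"] conjI allI impI)
    fix j assume "Suc j < Suc k"
    then show "(f(k := M)) (Suc j) + 2 \<le> (f(k := M)) j"
      using f(1)[of j] f(2)[of j] by (cases "Suc j = k") auto
  qed (use f(1) in \<open>auto simp: less_Suc_eq\<close>)
qed

definition chain_set :: "nat \<Rightarrow> nat \<Rightarrow> nat multiset set" where
  "chain_set k M = {p \<in> parts_ge M. gap_chain k (set_mset p)}"

lemma chain_set_recursion:
  assumes "0 < M"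
  shows "(1 - fps_X ^ M) * (1 - fps_X ^ Suc M) *
           (gf (chain_set (Suc k) M) - gf (chain_set (Suc k) (Suc M)))
         = fps_X ^ M * gf (chain_set k (M + 2))"
proof -
  let ?S = "chain_set (Suc k) M" and ?Q = "\<lambda>p. gap_chain k (set_mset p)"
  have "?S \<subseteq> parts_ge 1"
    using assms by (auto simp: chain_set_def parts_ge_def)
  then have "gf ?S = gf {p \<in> ?S. M \<notin># p} + fps_X ^ M * gf {p. add_mset M p \<in> ?S}"
    by (rule gf_split)
  moreover have "{p \<in> ?S. M \<notin># p} = chain_set (Suc k) (Suc M)"
    by (auto simp: chain_set_def parts_ge_Suc_iff)
  \<comment> \<open>The extra \<open>M\<close> can end the chain, so the parts \<open>M\<close> and
    \<open>M + 1\<close> of the rest are free. Removing them one after the other yields the two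
    factors on the left-hand side.\<close>
  moreover have "{p. add_mset M p \<in> ?S} = constrained ?Q (M + 2) M"
  proof -
    have "set_mset (filter_mset (\<lambda>x. M + 2 \<le> x) p) = set_mset p \<inter> {M + 2..}" for p
      by auto
    then show ?thesis
      by (auto simp: chain_set_def constrained_def parts_ge_def gap_chain_insert_least subset_iff
          simp del: set_mset_filter)
  qed
  ultimately have "gf ?S - gf (chain_set (Suc k) (Suc M)) = fps_X ^ M * gf (constrained ?Q (M + 2) M)"
    by simp
  moreover have "(1 - fps_X ^ M) * gf (constrained ?Q (M + 2) M) = gf (constrained ?Q (M + 2) (Suc M))"
    using assms by (intro gf_constrained_Suc) auto
  moreover have "(1 - fps_X ^ Suc M) * gf (constrained ?Q (M + 2) (Suc M))
      = gf (constrained ?Q (M + 2) (Suc (Suc M)))"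
    by (intro gf_constrained_Suc) auto
  moreover have "constrained ?Q (M + 2) (Suc (Suc M)) = chain_set k (M + 2)"
  proof -
    have "filter_mset (\<lambda>x. M + 2 \<le> x) p = p" if "p \<in> parts_ge (M + 2)" for p
      using that by (simp add: parts_ge_def filter_mset_eq_conv)
    then show ?thesis
      by (auto simp: constrained_def chain_set_def simp del: set_mset_filter)
  qed
  ultimately show ?thesis
    by (metis (no_types, lifting) mult.assoc mult.left_commute)
qed

section \<open>Durfee rectangles\<close>

definition big :: "nat \<Rightarrow> nat multiset \<Rightarrow> nat" where
  "big L p = size (filter_mset (\<lambda>x. L \<le> x) p)"

lemma big_parts_ge: "p \<in> parts_ge M \<Longrightarrow> L \<le> M \<Longrightarrow> big L p = size p"
  unfolding big_def
  by (rule arg_cong[of _ _ size]) (auto simp: parts_ge_def filter_mset_eq_conv)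

lemma big_antimono: "L \<le> N \<Longrightarrow> big N p \<le> big L p"
  unfolding big_def by (intro size_mset_mono filter_mset_mono_strong) auto

text \<open>Adding 1 to each of the \<open>k\<close> parts is a bijection that raises the sum by
  \<open>k\<close>.\<close>

lemma gf_parts_ge_Suc_size:
  "gf {p \<in> parts_ge (Suc M). size p = k} = fps_X ^ k * gf {p \<in> parts_ge M. size p = k}"
proof -
  let ?S = "{p \<in> parts_ge M. size p = k}"
  have "{p \<in> parts_ge (Suc M). size p = k} = image_mset Suc ` ?S"
  proof (intro equalityI subsetI)
    fix p assume p: "p \<in> {p \<in> parts_ge (Suc M). size p = k}"
    have "image_mset (\<lambda>x. Suc (x - 1)) p = image_mset (\<lambda>x. x) p"
      by (rule image_mset_cong) (use p in \<open>auto simp: parts_ge_def\<close>)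
    then have "p = image_mset Suc (image_mset (\<lambda>x. x - 1) p)"
      by (simp add: multiset.map_comp comp_def)
    moreover have "image_mset (\<lambda>x. x - 1) p \<in> ?S"
      using p by (auto simp: parts_ge_def)
    ultimately show "p \<in> image_mset Suc ` ?S" by (rule image_eqI)
  qed (auto simp: parts_ge_def)
  moreover have "gf (image_mset Suc ` ?S) = fps_X ^ k * gf ?S"
  proof (rule gf_image_shift)
    have "inj (image_mset Suc)" by (simp add: multiset.inj_map)
    then show "inj_on (image_mset Suc) ?S" by (rule inj_on_subset) simp
    have "sum_mset (image_mset Suc p) = sum_mset p + size p" for p
      by (induction p) auto
    then show "sum_mset (image_mset Suc p) = sum_mset p + k" if "p \<in> ?S" for p
      using that by simp
  qed
  ultimately show ?thesis by simp
qed

text \<open>The Ferrers diagram contains a rectangle of \<open>k\<close> rows and \<open>L\<close>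
  columns.\<close>

definition rect_set :: "nat \<Rightarrow> nat \<Rightarrow> nat \<Rightarrow> nat multiset set" where
  "rect_set k L M = {p \<in> parts_ge M. k \<le> big L p}"

text \<open>Equivalently, the part in position \<open>k + 1\<close> of the nonincreasing order,
  counted from 1, equals \<open>L\<close>. These partitions leave
  \<open>rect_set (Suc k) L M\<close> when \<open>L\<close> grows by 1.\<close>

definition tie_set :: "nat \<Rightarrow> nat \<Rightarrow> nat \<Rightarrow> nat multiset set" where
  "tie_set k L M = {p \<in> parts_ge M. Suc k \<le> big L p \<and> big (Suc L) p \<le> k}"

definition exact_set :: "nat \<Rightarrow> nat \<Rightarrow> nat \<Rightarrow> nat multiset set" where
  "exact_set k L M = {p \<in> parts_ge M. big L p = k}"

lemma rect_set_constrained: "rect_set k L M = constrained (\<lambda>p. k \<le> size p) L M"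
  by (simp add: rect_set_def constrained_def big_def)

lemma exact_set_constrained: "exact_set k L M = constrained (\<lambda>p. size p = k) L M"
  by (simp add: exact_set_def constrained_def big_def)

lemma tie_set_constrained:
  "tie_set k L M = constrained (\<lambda>p. Suc k \<le> size p \<and> big (Suc L) p \<le> k) L M"
proof -
  have "filter_mset (\<lambda>x. Suc L \<le> x) (filter_mset (\<lambda>x. L \<le> x) p) = filter_mset (\<lambda>x. Suc L \<le> x) p" for p
    by (auto simp: filter_filter_mset intro: filter_mset_cong)
  then show ?thesis
    by (simp add: tie_set_def constrained_def big_def)
qed

text \<open>With all parts at least \<open>L\<close>, a tie must contain \<open>L\<close>. Removing
  one \<open>L\<close> leaves either a tie or a partition into exactly \<open>k\<close> parts, so
  \<open>T = q^L (T + E)\<close>.\<close>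

lemma tie_set_base:
  assumes "0 < L" "k \<le> L"
  shows "(1 - fps_X ^ L) * gf (tie_set k L L) = fps_X ^ (L - k) * gf (exact_set k (Suc L) (Suc L))"
proof -
  let ?T = "tie_set k L L" and ?E = "{p \<in> parts_ge L. size p = k}"
  have pos: "parts_ge L \<subseteq> parts_ge 1"
    using assms by (intro parts_ge_antimono) simp
  then have sub: "?T \<subseteq> parts_ge 1" "?E \<subseteq> parts_ge 1"
    by (auto simp: tie_set_def)
  have "{p \<in> ?T. L \<notin># p} = {}"
  proof -
    have "big (Suc L) p = big L p" if "p \<in> parts_ge L" "L \<notin># p" for p
    proof -
      have "p \<in> parts_ge (Suc L)"
        using that by (simp add: parts_ge_Suc_iff)
      then show ?thesis by (simp add: big_parts_ge)
    qed
    then show ?thesis by (force simp: tie_set_def)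
  qed
  moreover have "{p. add_mset L p \<in> ?T} = ?T \<union> ?E"
  proof -
    have "add_mset L p \<in> ?T \<longleftrightarrow> p \<in> parts_ge L \<and> k \<le> size p \<and> big (Suc L) p \<le> k" for p
    proof -
      have "add_mset L p \<in> parts_ge L \<longleftrightarrow> p \<in> parts_ge L"
        by (auto simp: parts_ge_def)
      moreover have "big L (add_mset L p) = Suc (big L p)" "big (Suc L) (add_mset L p) = big (Suc L) p"
        by (auto simp: big_def)
      ultimately show ?thesis
        by (auto simp: tie_set_def big_parts_ge)
    qed
    moreover have "p \<in> ?T \<union> ?E \<longleftrightarrow> p \<in> parts_ge L \<and> k \<le> size p \<and> big (Suc L) p \<le> k" for p
      using big_antimono[of L "Suc L" p] by (auto simp: tie_set_def big_parts_ge)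
    ultimately show ?thesis by blast
  qed
  moreover have "gf (?T \<union> ?E) = gf ?T + gf ?E"
    using sub by (intro gf_Un_disjoint) (auto simp: tie_set_def big_parts_ge)
  moreover have "gf {} = 0"
    by (rule fps_ext) (simp add: gf_nth)
  ultimately have "gf ?T = fps_X ^ L * (gf ?T + gf ?E)"
    using gf_split[OF sub(1), of L] by (simp only: add_0_left)
  then have "(1 - fps_X ^ L) * gf ?T = fps_X ^ L * gf ?E"
    by (simp add: algebra_simps)
  \<comment> \<open>Because \<open>k \<le> L\<close>, a factor \<open>q^k\<close> can be taken out
    of \<open>q^L\<close>; it raises each of the \<open>k\<close> parts by 1.\<close>
  also have "\<dots> = fps_X ^ (L - k) * gf {p \<in> parts_ge (Suc L). size p = k}"
    using assms by (simp add: gf_parts_ge_Suc_size flip: mult.assoc power_add)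
  also have "{p \<in> parts_ge (Suc L). size p = k} = exact_set k (Suc L) (Suc L)"
    by (auto simp: exact_set_def big_parts_ge)
  finally show ?thesis .
qed

text \<open>
  This is the step behind the recursion for \<open>d\<close>: parts below the rectangle only contribute factors
  \<open>1 / (1 - q\<^sup>j)\<close>, and after removing them the claim compares partitions into \<open>k\<close> parts that are at
  least \<open>L\<close> with those into \<open>k\<close> parts that are at least \<open>L + 1\<close>.
\<close>
lemma tie_set_exact_set:
  assumes "k \<le> L" "0 < M" "M \<le> L"
  shows "(1 - fps_X ^ M) * gf (tie_set k L M) = fps_X ^ (L - k) * gf (exact_set k (Suc L) (Suc M))"
  using assms(3,2)
\<comment> \<open>The induction runs downward from \<open>M = L\<close>. In the step, both sides are
  compared after multiplication by \<open>1 - q^(M+1)\<close>, which is cancelled at the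
  end.\<close>
proof (induction M rule: inc_induct)
  case base
  then show ?case using assms(1) by (intro tie_set_base)
next
  case (step M)
  let ?E = "\<lambda>M. gf (exact_set k (Suc L) M)"
  have "(1 - fps_X ^ Suc M) * ((1 - fps_X ^ M) * gf (tie_set k L M))
      = (1 - fps_X ^ Suc M) * gf (tie_set k L (Suc M))"
    using step by (simp add: tie_set_constrained gf_constrained_Suc)
  also have "\<dots> = fps_X ^ (L - k) * ?E (Suc (Suc M))"
    using step by simp
  also have "?E (Suc (Suc M)) = (1 - fps_X ^ Suc M) * ?E (Suc M)"
    unfolding exact_set_constrained using step by (intro gf_constrained_Suc[symmetric]) auto
  finally have "(1 - fps_X ^ Suc M) * ((1 - fps_X ^ M) * gf (tie_set k L M))
      = (1 - fps_X ^ Suc M) * (fps_X ^ (L - k) * ?E (Suc M))"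
    by (simp only: ac_simps)
  then show ?case
    using one_minus_X_power_nonzero[of "Suc M"] by (metis mult_left_cancel zero_less_Suc)
qed

text \<open>The rectangle condition here only says that the partition is nonempty. It has to be
  treated separately because the threshold equals \<open>M\<close>, so the part \<open>M\<close> is
  not free. Removing one \<open>M\<close> leaves an arbitrary partition.\<close>

lemma rect_set_recursion_1:
  assumes "0 < M"
  shows "(1 - fps_X ^ M) * (1 - fps_X ^ Suc M) *
           (gf (rect_set 1 M M) - gf (rect_set 1 (Suc M) (Suc M)))
         = fps_X ^ M * gf (rect_set 0 (Suc M) (M + 2))"
proof -
  let ?S = "rect_set 1 M M" and ?All = "\<lambda>_. True"
  have "?S \<subseteq> parts_ge 1"
    using assms by (auto simp: rect_set_def parts_ge_def)
  then have "gf ?S = gf {p \<in> ?S. M \<notin># p} + fps_X ^ M * gf {p. add_mset M p \<in> ?S}"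
    by (rule gf_split)
  moreover have "{p \<in> ?S. M \<notin># p} = rect_set 1 (Suc M) (Suc M)"
  proof -
    have "big (Suc M) p = big M p" if "p \<in> parts_ge (Suc M)" for p
      using that by (simp add: big_parts_ge)
    then show ?thesis
      by (auto simp: rect_set_def parts_ge_Suc_iff)
  qed
  moreover have "{p. add_mset M p \<in> ?S} = constrained ?All (M + 2) M"
    by (auto simp: rect_set_def constrained_def parts_ge_def big_def)
  ultimately have "gf ?S - gf (rect_set 1 (Suc M) (Suc M)) = fps_X ^ M * gf (constrained ?All (M + 2) M)"
    by simp
  moreover have "(1 - fps_X ^ M) * gf (constrained ?All (M + 2) M) = gf (constrained ?All (M + 2) (Suc M))"
    using assms by (intro gf_constrained_Suc) auto
  moreover have "(1 - fps_X ^ Suc M) * gf (constrained ?All (M + 2) (Suc M))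
      = gf (constrained ?All (M + 2) (Suc (Suc M)))"
    by (intro gf_constrained_Suc) auto
  moreover have "constrained ?All (M + 2) (Suc (Suc M)) = rect_set 0 (Suc M) (M + 2)"
    by (auto simp: constrained_def rect_set_def)
  ultimately show ?thesis
    by (metis (no_types, lifting) mult.assoc mult.left_commute)
qed

text \<open>As \<open>k > 0\<close>, the part \<open>M\<close> lies below the rectangle width and is
  free. Freeing the left-hand side of it gives \<open>(1 - q^M) (B - B') = T + q^M B'\<close>;
  multiplied by \<open>1 - q^(M+1)\<close>, the ties \<open>T\<close> become those with exactly
  \<open>k\<close> long parts and \<open>B'\<close> those with more than \<open>k\<close>.\<close>

lemma rect_set_recursion_2:
  assumes "0 < M" "0 < k"
  shows "(1 - fps_X ^ M) * (1 - fps_X ^ Suc M) *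
           (gf (rect_set (Suc k) (M + k) M) - gf (rect_set (Suc k) (Suc (M + k)) (Suc M)))
         = fps_X ^ M * gf (rect_set k (Suc (M + k)) (M + 2))"
proof -
  let ?L = "M + k"
  let ?x = "fps_X ^ M :: int fps" and ?y = "fps_X ^ Suc M :: int fps"
  let ?B = "gf (rect_set (Suc k) ?L M)" and ?B' = "gf (rect_set (Suc k) (Suc ?L) (Suc M))"
  let ?T = "gf (tie_set k ?L (Suc M))"
  let ?E = "gf (exact_set k (Suc ?L) (M + 2))" and ?B'' = "gf (rect_set (Suc k) (Suc ?L) (M + 2))"
  have pos: "parts_ge (Suc N) \<subseteq> parts_ge 1" for N
    by (rule parts_ge_antimono) simp
  have "(1 - ?x) * ?B = gf (rect_set (Suc k) ?L (Suc M))"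
    unfolding rect_set_constrained using assms by (intro gf_constrained_Suc) auto
  also have "rect_set (Suc k) ?L (Suc M) = tie_set k ?L (Suc M) \<union> rect_set (Suc k) (Suc ?L) (Suc M)"
    by (auto simp: rect_set_def tie_set_def intro: le_trans[OF _ big_antimono[of ?L "Suc ?L"]])
  also have "gf \<dots> = ?T + ?B'"
    using pos by (intro gf_Un_disjoint) (auto simp: rect_set_def tie_set_def)
  finally have B: "(1 - ?x) * ?B = ?T + ?B'" .
  \<comment> \<open>The width \<open>M + k\<close> is chosen such that the exponent
    \<open>L - k\<close> is exactly \<open>M\<close>.\<close>
  have T: "(1 - ?y) * ?T = ?x * ?E"
    using tie_set_exact_set[of k ?L "Suc M"] assms by simp
  have B': "(1 - ?y) * ?B' = ?B''"
    unfolding rect_set_constrained using assms gf_constrained_Suc[of "Suc M" "Suc ?L"] by simp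
  have "rect_set k (Suc ?L) (M + 2) = exact_set k (Suc ?L) (M + 2) \<union> rect_set (Suc k) (Suc ?L) (M + 2)"
    by (auto simp: rect_set_def exact_set_def)
  then have "gf (rect_set k (Suc ?L) (M + 2))
      = gf (exact_set k (Suc ?L) (M + 2) \<union> rect_set (Suc k) (Suc ?L) (M + 2))"
    by (rule arg_cong)
  also have "\<dots> = ?E + ?B''"
    using pos[of "Suc M"] by (intro gf_Un_disjoint) (auto simp: rect_set_def exact_set_def)
  finally have E: "gf (rect_set k (Suc ?L) (M + 2)) = ?E + ?B''" .
  have "(1 - ?x) * (1 - ?y) * (?B - ?B') = (1 - ?y) * ((1 - ?x) * ?B) - (1 - ?x) * ((1 - ?y) * ?B')"
    by (simp only: algebra_simps)
  also have "\<dots> = (1 - ?y) * ?T + ?x * ((1 - ?y) * ?B')"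
    unfolding B by (simp only: algebra_simps mult_1_left)
  also have "\<dots> = ?x * gf (rect_set k (Suc ?L) (M + 2))"
    unfolding T B' E by (simp only: distrib_left)
  finally show ?thesis .
qed

text \<open>For \<open>M = 1\<close> the rectangle is a square of side \<open>k\<close>. Passing
  from \<open>(k + 1, M)\<close> to \<open>(k, M + 2)\<close> widens the rectangle by 1.\<close>

definition durfee_set :: "nat \<Rightarrow> nat \<Rightarrow> nat multiset set" where
  "durfee_set k M = rect_set k (M + k - 1) M"

lemma durfee_set_recursion:
  assumes "0 < M"
  shows "(1 - fps_X ^ M) * (1 - fps_X ^ Suc M) *
           (gf (durfee_set (Suc k) M) - gf (durfee_set (Suc k) (Suc M)))
         = fps_X ^ M * gf (durfee_set k (M + 2))"
proof (cases "k = 0")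
  case True
  then show ?thesis using rect_set_recursion_1[OF assms] by (simp add: durfee_set_def)
next
  case False
  then show ?thesis using rect_set_recursion_2[OF assms] by (simp add: durfee_set_def)
qed

section \<open>Comparison\<close>

lemma gf_nth_eq_0:
  assumes "n < M" "S \<subseteq> parts_ge M" "{#} \<notin> S"
  shows "fps_nth (gf S) n = 0"
proof -
  have "M \<le> sum_mset p" if "p \<in> S" for p
  proof -
    obtain x q where "p = add_mset x q"
      using assms(3) \<open>p \<in> S\<close> by (metis multiset_cases)
    moreover have "M \<le> x"
      using assms(2) \<open>p \<in> S\<close> \<open>p = add_mset x q\<close> by (auto simp: parts_ge_def)
    ultimately show ?thesis by simp
  qed
  then have "{p \<in> S. sum_mset p = n} = {}"
    using assms(1) by fastforce
  then show ?thesis by (simp only: gf_nth) simp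
qed

lemma gf_chain_set_eq_durfee_set:
  assumes "0 < M"
  shows "gf (chain_set k M) = gf (durfee_set k M)"
  using assms
proof (induction k arbitrary: M)
  case 0
  show ?case
    by (simp add: chain_set_def durfee_set_def rect_set_def gap_chain_def)
next
  case (Suc k)
  \<comment> \<open>By the induction hypothesis both recursions have the same right-hand side, so
    this difference does not depend on \<open>M\<close>.\<close>
  define e where "e M = gf (chain_set (Suc k) M) - gf (durfee_set (Suc k) M)" for M
  have e_Suc: "e N = e (Suc N)" if "0 < N" for N
  proof -
    have "(1 - fps_X ^ N) * (1 - fps_X ^ Suc N) * (e N - e (Suc N)) =
        fps_X ^ N * gf (chain_set k (N + 2)) - fps_X ^ N * gf (durfee_set k (N + 2))"
      unfolding chain_set_recursion[OF that, symmetric] durfee_set_recursion[OF that, symmetric] e_def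
      by (simp only: algebra_simps)
    also have "\<dots> = 0" using Suc.IH[of "N + 2"] by simp
    finally show ?thesis
      using one_minus_X_power_nonzero[of N] one_minus_X_power_nonzero[of "Suc N"] that
      by (metis eq_iff_diff_eq_0 mult_eq_0_iff zero_less_Suc)
  qed
  have "fps_nth (e M) n = 0" for n
  proof -
    have "e M = e (M + j)" for j
      using Suc.prems by (induction j) (simp_all flip: e_Suc)
    \<comment> \<open>All parts now exceed \<open>n\<close>, and the empty partition is excluded
      because \<open>Suc k\<close> is positive.\<close>
    moreover have "fps_nth (e (M + Suc n)) n = 0"
      using gf_nth_eq_0[of n "M + Suc n" "chain_set (Suc k) (M + Suc n)"]
        gf_nth_eq_0[of n "M + Suc n" "durfee_set (Suc k) (M + Suc n)"]
      by (auto simp: e_def chain_set_def durfee_set_def rect_set_def big_def gap_chain_def)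
    ultimately show ?thesis by metis
  qed
  then have "e M = 0" by (auto intro: fps_ext)
  then show ?case by (simp add: e_def)
qed

lemma C_set_iff_gap_chain:
  "l \<in> C_set m n \<longleftrightarrow> l \<in> partitions n \<and> gap_chain m (set l)"
proof (intro iffI conjI)
  assume "l \<in> C_set m n"
  then obtain i where "l \<in> partitions n" "\<forall>j<m. i j < length l"
    "\<forall>j. Suc j < m \<longrightarrow> l ! i (Suc j) + 2 \<le> l ! i j"
    unfolding C_set_def by blast
  then show "l \<in> partitions n" "gap_chain m (set l)"
    unfolding gap_chain_def by (auto intro: exI[of _ "\<lambda>j. l ! i j"])
next
  assume asm: "l \<in> partitions n \<and> gap_chain m (set l)"
  then obtain f where f: "\<And>j. j < m \<Longrightarrow> f j \<in> set l" "\<And>j. Suc j < m \<Longrightarrow> f (Suc j) + 2 \<le> f j"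
    unfolding gap_chain_def by blast
  have "\<forall>j. \<exists>i. j < m \<longrightarrow> i < length l \<and> l ! i = f j"
    using f(1) by (metis in_set_conv_nth)
  then obtain i where i: "\<And>j. j < m \<Longrightarrow> i j < length l" "\<And>j. j < m \<Longrightarrow> l ! i j = f j"
    by metis
  have f_less: "f b < f a" if "a < b" "b < m" for a b
    using that
  proof (induction b)
    case (Suc b)
    then show ?case using f(2)[of b] by (cases "a = b") auto
  qed simp
  \<comment> \<open>The chosen values strictly decrease and the list is nonincreasing, so any choice
    of positions for them strictly increases.\<close>
  have "i a < i b" if "a < b" "b < m" for a b
  proof (rule ccontr)
    assume "\<not> i a < i b"
    moreover have "sorted_wrt (\<ge>) l" using asm by (simp add: partitions_def)
    ultimately have "l ! i a \<le> l ! i b"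
      using i(1)[of a] that by (cases "i a = i b") (auto simp: sorted_wrt_iff_nth_less)
    then show False using f_less[OF that] i(2) that by simp
  qed
  then have "strict_mono_on {..<m} i"
    by (auto simp: strict_mono_on_def)
  moreover have "\<forall>j. Suc j < m \<longrightarrow> l ! i (Suc j) + 2 \<le> l ! i j"
    using f(2) i(2) by simp
  ultimately show "l \<in> C_set m n"
    using asm i(1) unfolding C_set_def by blast
qed

lemma card_partitions_gf:
  assumes "S \<subseteq> parts_ge 1"
  shows "int (card {l \<in> partitions n. mset l \<in> S}) = fps_nth (gf S) n"
proof -
  have "bij_betw mset {l \<in> partitions n. mset l \<in> S} {p \<in> S. sum_mset p = n}"
    unfolding bij_betw_def
  proof
    show "inj_on mset {l \<in> partitions n. mset l \<in> S}"
      by (rule inj_on_subset[OF bij_betw_imp_inj_on[OF mset_partitions]]) auto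
    show "mset ` {l \<in> partitions n. mset l \<in> S} = {p \<in> S. sum_mset p = n}"
    proof -
      have "mset ` {l \<in> partitions n. mset l \<in> S} = mset ` partitions n \<inter> S"
        by (rule equalityI) auto
      then show ?thesis
        unfolding bij_betw_imp_surj_on[OF mset_partitions[of n]] using assms by auto
    qed
  qed
  then show ?thesis by (simp add: gf_nth bij_betw_same_card)
qed

theorem theorem5:
  fixes m n :: nat
  assumes "1 \<le> m"
  shows "card (C_set m n) = card (D_set m n)"
proof -
  have parts: "mset l \<in> parts_ge 1" if "l \<in> partitions n" for l
    using that by (auto simp: partitions_def parts_ge_def Suc_le_eq)
  have "C_set m n = {l \<in> partitions n. mset l \<in> chain_set m 1}"
    using parts by (auto simp: C_set_iff_gap_chain chain_set_def)
  moreover have "D_set m n = {l \<in> partitions n. mset l \<in> durfee_set m 1}"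
    using parts by (auto simp: D_set_def durfee_set_def rect_set_def big_def simp flip: mset_filter)
  moreover have "chain_set m 1 \<subseteq> parts_ge 1" "durfee_set m 1 \<subseteq> parts_ge 1"
    by (auto simp: chain_set_def durfee_set_def rect_set_def)
  ultimately have "int (card (C_set m n)) = fps_nth (gf (chain_set m 1)) n"
    "int (card (D_set m n)) = fps_nth (gf (durfee_set m 1)) n"
    by (simp_all only: card_partitions_gf)
  then show ?thesis
    using gf_chain_set_eq_durfee_set[of 1 m] by simp
qed

end
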